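(* Let $(\gamma^{(k)})_{k\ge 0}$ be a sequence in $\mathbb{R}^n_{++}$ such that $x^{(k)}:=\mu(\gamma^{(k)})$ satisfies $x^{(k)}_i\neq 0$ for all $1\le i\le n$ and all $k\ge 0$. Then the iteration scheme $$\gamma^{(k+1)}=\mathop{\arg\min}_{\gamma\in\mathbb{R}^n_{++}} F(x^{(k)},\gamma)+\tilde g_{\mathrm{MK}}(\gamma,\gamma^{(k)}),\qquad k\ge 0,$$ is equivalent to the MacKay (MK) algorithm $$\gamma^{(k+1)}_i=\gamma_i^{(k)}\,\frac{[\mu(\gamma^{(k)})]_i^2}{\gamma_i^{(k)}-[\Sigma(\gamma^{(k)})]_{ii}},\qquad 1\le i\le n,\ k\ge 0;$$ that is, $(\gamma^{(k)})$ satisfies the first recursion for every $k$ (meaning $\gamma^{(k+1)}$ is the unique minimizer) if and only if it satisfies the second recursion for every $k$, so that from the same initial estimate $\gamma^{(0)}$ both generate the same sequence.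
   Context: Setting: $\mathsf F\in\mathbb{R}^{m\times n}$ is a given matrix, $y\in\mathbb{R}^m$, $\beta>0$. $\mathbb{R}^n_{++}=\{u\in\mathbb{R}^n:u_i>0\ \forall i\}$. For $\gamma\in\mathbb{R}^n_{++}$ let $\Gamma=\operatorname{diag}(\gamma)$, $S(\gamma)=\beta^{-1}I+\mathsf F\Gamma\mathsf F^{T}$, $\mu(\gamma)=\Gamma\mathsf F^{T}S(\gamma)^{-1}y\in\mathbb{R}^n$, and $\Sigma(\gamma)=\Gamma-\Gamma\mathsf F^{T}S(\gamma)^{-1}\mathsf F\Gamma$. For $x\in\mathbb{R}^n$, $\gamma\in\mathbb{R}^n_{++}$, $$F(x,\gamma)=\beta\|\mathsf Fx-y\|^2+\sum_{i=1}^n\frac{x_i^2}{\gamma_i}.$$ The MK surrogate function is, for $\gamma,\gamma^{(k)}\in\mathbb{R}^n_{++}$, $$\tilde g_{\mathrm{MK}}(\gamma,\gamma^{(k)})=\log\det S(\gamma^{(k)})+\sum_{i=1}^n\Big(1-\frac{[\Sigma(\gamma^{(k)})]_{ii}}{\gamma_i^{(k)}}\Big)\big(\log\gamma_i-\log\gamma_i^{(k)}\big).$$ *)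

theory Defs
  imports "HOL-Analysis.Analysis"
begin

definition pos_orthant :: "(real ^ 'n) set"
  where "pos_orthant = {u. \<forall>i. 0 < u $ i}"

definition diag_mat :: "real ^ 'n \<Rightarrow> real ^ 'n ^ 'n"
  where "diag_mat u = (\<chi> i j. if i = j then u $ i else 0)"

text \<open>
  The forward matrix (\<open>F\<close> in sans serif in the mathematical text) is written \<open>A\<close> here, since
  \<open>F\<close> also names the objective \<open>F_obj\<close>. For \<open>\<beta> > 0\<close> and positive \<open>\<gamma>\<close> the matrix \<open>S_mat A \<beta> \<gamma>\<close> is positive
  definite, so \<^const>\<open>matrix_inv\<close> is a genuine inverse below and \<open>ln (det _)\<close> is the genuine
  log-determinant.
\<close>

definition S_mat :: "real ^ 'n ^ 'm \<Rightarrow> real \<Rightarrow> real ^ 'n \<Rightarrow> real ^ 'm ^ 'm"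
  where "S_mat A \<beta> \<gamma> = inverse \<beta> *\<^sub>R mat 1 + A ** diag_mat \<gamma> ** transpose A"

definition post_mean :: "real ^ 'n ^ 'm \<Rightarrow> real \<Rightarrow> real ^ 'm \<Rightarrow> real ^ 'n \<Rightarrow> real ^ 'n"
  where "post_mean A \<beta> y \<gamma> = (diag_mat \<gamma> ** transpose A ** matrix_inv (S_mat A \<beta> \<gamma>)) *v y"

definition post_cov :: "real ^ 'n ^ 'm \<Rightarrow> real \<Rightarrow> real ^ 'n \<Rightarrow> real ^ 'n ^ 'n"
  where "post_cov A \<beta> \<gamma> =
    diag_mat \<gamma> - diag_mat \<gamma> ** transpose A ** matrix_inv (S_mat A \<beta> \<gamma>) ** A ** diag_mat \<gamma>"

definition F_obj :: "real ^ 'n ^ 'm \<Rightarrow> real \<Rightarrow> real ^ 'm \<Rightarrow> real ^ 'n \<Rightarrow> real ^ 'n \<Rightarrow> real"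
  where "F_obj A \<beta> y x \<gamma> = \<beta> * (norm (A *v x - y))\<^sup>2 + (\<Sum>i\<in>UNIV. (x $ i)\<^sup>2 / \<gamma> $ i)"

definition g_MK :: "real ^ 'n ^ 'm \<Rightarrow> real \<Rightarrow> real ^ 'n \<Rightarrow> real ^ 'n \<Rightarrow> real"
  where "g_MK A \<beta> \<gamma> \<gamma>k =
    ln (det (S_mat A \<beta> \<gamma>k)) +
    (\<Sum>i\<in>UNIV. (1 - post_cov A \<beta> \<gamma>k $ i $ i / \<gamma>k $ i) * (ln (\<gamma> $ i) - ln (\<gamma>k $ i)))"

definition is_unique_arg_min :: "('a \<Rightarrow> 'b::ord) \<Rightarrow> ('a \<Rightarrow> bool) \<Rightarrow> 'a \<Rightarrow> bool"
  where "is_unique_arg_min f P x \<longleftrightarrow> is_arg_min f P x \<and> (\<forall>z. is_arg_min f P z \<longrightarrow> z = x)"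

definition surrogate_recursion ::
  "real ^ 'n ^ 'm \<Rightarrow> real \<Rightarrow> real ^ 'm \<Rightarrow> (nat \<Rightarrow> real ^ 'n) \<Rightarrow> bool"
  where "surrogate_recursion A \<beta> y \<gamma> \<longleftrightarrow>
    (\<forall>k. is_unique_arg_min
           (\<lambda>u. F_obj A \<beta> y (post_mean A \<beta> y (\<gamma> k)) u + g_MK A \<beta> u (\<gamma> k))
           (\<lambda>u. u \<in> pos_orthant)
           (\<gamma> (Suc k)))"

text \<open>
  Division by zero does not arise below when \<open>\<gamma> k\<close> is positive and all components of the mean are
  nonzero: \<open>\<gamma>\<^sub>i - \<Sigma>\<^sub>i\<^sub>i = \<gamma>\<^sub>i\<^sup>2 (A\<^sup>T S\<^sup>-\<^sup>1 A)\<^sub>i\<^sub>i\<close> vanishes only if column \<open>i\<close> of \<open>A\<close> is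
  zero, and then the \<open>i\<close>-th component of the mean is zero.
\<close>

definition MK_recursion ::
  "real ^ 'n ^ 'm \<Rightarrow> real \<Rightarrow> real ^ 'm \<Rightarrow> (nat \<Rightarrow> real ^ 'n) \<Rightarrow> bool"
  where "MK_recursion A \<beta> y \<gamma> \<longleftrightarrow>
    (\<forall>k i. \<gamma> (Suc k) $ i =
       \<gamma> k $ i * ((post_mean A \<beta> y (\<gamma> k) $ i)\<^sup>2 / (\<gamma> k $ i - post_cov A \<beta> (\<gamma> k) $ i $ i)))"

end

theory Submission
  imports Defs
begin

text \<open>
  Up to an additive constant, the surrogate objective separates into the scalar functions
  \<open>c / t + w * ln t\<close> with \<open>c = x\<^sub>i\<^sup>2\<close> and \<open>w = 1 - \<Sigma>\<^sub>i\<^sub>i / \<gamma>\<^sub>i = \<gamma>\<^sub>i (A\<^sup>T S\<^sup>-\<^sup>1 A)\<^sub>i\<^sub>i\<close>. When \<open>c, w > 0\<close>, the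
  inequality \<open>ln s \<le> s - 1\<close>, strict unless \<open>s = 1\<close>, shows that \<open>t = c / w\<close> is the strict minimum, and
  this is the MacKay update. Positivity of \<open>w\<close> holds because \<open>S\<^sup>-\<^sup>1\<close> is positive definite and the
  \<open>i\<close>-th column of \<open>A\<close> is nonzero, the latter because \<open>x\<^sub>i \<noteq> 0\<close>.
\<close>

text \<open>\<open>is_arg_min\<close> only forbids strictly smaller values, so strictness is what
  rules out every other minimizer.\<close>

lemma is_unique_arg_min_strict_iff:
  fixes f :: "'a \<Rightarrow> 'b::order"
  assumes "P a" and "\<And>z. P z \<Longrightarrow> z \<noteq> a \<Longrightarrow> f a < f z"
  shows "is_unique_arg_min f P u \<longleftrightarrow> u = a"
proof -
  have "is_arg_min f P z \<longleftrightarrow> z = a" for z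
    unfolding is_arg_min_def using assms by (metis order.asym)
  then show ?thesis
    by (auto simp: is_unique_arg_min_def)
qed

lemma divide_plus_ln_minimum:
  fixes c w t :: real
  assumes "c > 0" "w > 0" "t > 0"
  shows "c / (c / w) + w * ln (c / w) \<le> c / t + w * ln t"
    and "c / (c / w) + w * ln (c / w) = c / t + w * ln t \<longleftrightarrow> t = c / w"
proof -
  \<comment> \<open>The ratio of the claimed minimizer to t; in terms of s the gap between the two
    values is \<open>w * (s - 1 - ln s)\<close>.\<close>
  define s where "s = c / w / t"
  have s: "s > 0" and ct: "c / t = w * s" and sw: "c / (c / w) = w"
    using assms by (auto simp: s_def)
  have "ln (c / w) = ln s + ln t"
    using assms s ln_mult_pos[of s t] by (simp add: s_def)
  then have diff: "(c / t + w * ln t) - (c / (c / w) + w * ln (c / w)) = w * (s - 1 - ln s)"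
    unfolding ct sw by (simp add: algebra_simps)
  have "0 \<le> w * (s - 1 - ln s)"
    using ln_le_minus_one[OF s] assms by simp
  with diff show "c / (c / w) + w * ln (c / w) \<le> c / t + w * ln t"
    by linarith
  have "ln s = s - 1 \<longleftrightarrow> s = 1"
    using ln_eq_minus_one[OF s] by auto
  also have "s = 1 \<longleftrightarrow> t = c / w"
    using assms by (auto simp: s_def field_simps)
  finally have "w * (s - 1 - ln s) = 0 \<longleftrightarrow> t = c / w"
    using assms by auto
  with diff show "c / (c / w) + w * ln (c / w) = c / t + w * ln t \<longleftrightarrow> t = c / w"
    by linarith
qed

lemma sum_divide_plus_ln_strict_minimum:
  fixes c w u a :: "real ^ 'n"
  assumes c: "\<And>i. c $ i > 0" and w: "\<And>i. w $ i > 0" and u: "u \<in> pos_orthant"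
    and a: "\<And>i. a $ i = c $ i / w $ i" and "u \<noteq> a"
  shows "(\<Sum>i\<in>UNIV. c $ i / a $ i + w $ i * ln (a $ i))
    < (\<Sum>i\<in>UNIV. c $ i / u $ i + w $ i * ln (u $ i))"
proof -
  have u: "u $ i > 0" for i
    using u by (simp add: pos_orthant_def)
  \<comment> \<open>No summand is smaller at u than at a, so one differing coordinate makes the
    whole sum strictly larger.\<close>
  obtain i where "u $ i \<noteq> a $ i"
    using \<open>u \<noteq> a\<close> by (auto simp: vec_eq_iff)
  then show ?thesis
    using divide_plus_ln_minimum[OF c w u] unfolding a
    by (intro sum_strict_mono_ex1) (auto simp: less_le)
qed

lemma diag_mat_mult_left: "(diag_mat u ** M) $ i $ j = u $ i * M $ i $ j"
  by (simp add: diag_mat_def matrix_matrix_mult_def if_distrib[where f="\<lambda>x. x * _"] cong: if_cong)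

lemma diag_mat_mult_right: "(M ** diag_mat u) $ i $ j = M $ i $ j * u $ j"
  by (simp add: diag_mat_def matrix_matrix_mult_def if_distrib[where f="\<lambda>x. _ * x"] cong: if_cong)

lemma diag_mat_mult_vec: "(diag_mat u *v x) $ i = u $ i * x $ i"
  by (simp add: diag_mat_def matrix_vector_mult_def if_distrib[where f="\<lambda>x. x * _"] cong: if_cong)

lemma transpose_mult_vec_nth: "(transpose A *v v) $ i = column i A \<bullet> (v :: real ^ 'm)"
  by (simp add: matrix_vector_mult_def transpose_def column_def inner_vec_def)

lemma matrix_mult_column: "column i (B ** A) = B *v column i A"
  by (simp add: column_def matrix_vector_mult_def matrix_matrix_mult_def vec_eq_iff)

lemma S_mat_quadratic_form:
  "v \<bullet> (S_mat A \<beta> \<gamma> *v v) = inverse \<beta> * (v \<bullet> v) + (\<Sum>i\<in>UNIV. \<gamma> $ i * (column i A \<bullet> v)\<^sup>2)"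
proof -
  have "v \<bullet> ((A ** diag_mat \<gamma> ** transpose A) *v v)
      = (transpose A *v v) \<bullet> (diag_mat \<gamma> *v (transpose A *v v))"
    \<comment> \<open>\<open>transpose_matrix_vector\<close> turns \<open>transpose A *v v\<close>
      into \<open>v v* A\<close>; it is held back until the second pass, after the factors have been
      moved across the inner product.\<close>
    by (simp add: matrix_vector_mul_assoc[symmetric] dot_lmul_matrix[symmetric]
        del: transpose_matrix_vector) (simp add: dot_lmul_matrix)
  also have "\<dots> = (\<Sum>i\<in>UNIV. \<gamma> $ i * (column i A \<bullet> v)\<^sup>2)"
    unfolding inner_vec_def[of "transpose A *v v"] diag_mat_mult_vec transpose_mult_vec_nth
    by (simp add: power2_eq_square algebra_simps)
  finally show ?thesis
    by (simp add: S_mat_def matrix_vector_mult_add_rdistrib inner_add_right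
        scaleR_matrix_vector_assoc[symmetric])
qed

lemma S_mat_positive_definite:
  assumes "\<beta> > 0" "\<gamma> \<in> pos_orthant" "v \<noteq> 0"
  shows "v \<bullet> (S_mat A \<beta> \<gamma> *v v) > 0"
  unfolding S_mat_quadratic_form using assms
  by (intro add_pos_nonneg sum_nonneg) (auto simp: pos_orthant_def less_imp_le)

lemma S_mat_mult_inverse:
  assumes "\<beta> > 0" "\<gamma> \<in> pos_orthant"
  shows "S_mat A \<beta> \<gamma> ** matrix_inv (S_mat A \<beta> \<gamma>) = mat 1"
proof -
  have "\<forall>v. S_mat A \<beta> \<gamma> *v v = 0 \<longrightarrow> v = 0"
    using S_mat_positive_definite[OF assms, of _ A] by (metis inner_zero_right less_irrefl)
  then have "invertible (S_mat A \<beta> \<gamma>)"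
    by (simp add: invertible_left_inverse matrix_left_invertible_ker)
  \<comment> \<open>\<open>matrix_inv\<close> is a Hilbert choice; invertibility supplies the
    witness that makes the choice a genuine inverse.\<close>
  then show ?thesis
    unfolding invertible_def matrix_inv_def by (rule someI_ex[THEN conjunct1])
qed

lemma S_mat_inverse_positive_definite:
  assumes "\<beta> > 0" "\<gamma> \<in> pos_orthant" "a \<noteq> 0"
  shows "a \<bullet> (matrix_inv (S_mat A \<beta> \<gamma>) *v a) > 0"
proof -
  \<comment> \<open>With S v = a, the form a \<bullet> S^-1 a becomes (S v) \<bullet> v, which is
    positive by definiteness of S itself.\<close>
  define v where "v = matrix_inv (S_mat A \<beta> \<gamma>) *v a"
  have "S_mat A \<beta> \<gamma> *v v = a"
    using assms by (simp add: v_def matrix_vector_mul_assoc S_mat_mult_inverse)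
  moreover from this have "v \<noteq> 0"
    using \<open>a \<noteq> 0\<close> by auto
  ultimately show ?thesis
    using S_mat_positive_definite[OF assms(1,2), of v A] by (simp add: v_def inner_commute)
qed

lemma post_mean_nth:
  "post_mean A \<beta> y \<gamma> $ i = \<gamma> $ i * (column i A \<bullet> (matrix_inv (S_mat A \<beta> \<gamma>) *v y))"
  by (simp add: post_mean_def matrix_vector_mul_assoc[symmetric] diag_mat_mult_vec
      transpose_mult_vec_nth del: transpose_matrix_vector)

text \<open>The MacKay denominator is a diagonal entry of \<Gamma> A^T S^-1 A \<Gamma>. Writing it
  as a quadratic form in column i lets definiteness of S^-1 decide its sign.\<close>

lemma post_cov_diagonal:
  "\<gamma> $ i - post_cov A \<beta> \<gamma> $ i $ i
    = (\<gamma> $ i)\<^sup>2 * (column i A \<bullet> (matrix_inv (S_mat A \<beta> \<gamma>) *v column i A))"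
proof -
  define T where "T = matrix_inv (S_mat A \<beta> \<gamma>)"
  \<comment> \<open>This bracketing leaves the two diagonal matrices outermost, where they only
    scale a row and a column.\<close>
  have "\<gamma> $ i - post_cov A \<beta> \<gamma> $ i $ i = (diag_mat \<gamma> ** (transpose A ** (T ** A)) ** diag_mat \<gamma>) $ i $ i"
    by (simp add: post_cov_def T_def matrix_mul_assoc) (simp add: diag_mat_def)
  also have "\<dots> = (\<gamma> $ i)\<^sup>2 * (transpose A ** (T ** A)) $ i $ i"
    by (simp only: diag_mat_mult_left diag_mat_mult_right) (simp add: power2_eq_square)
  also have "(transpose A ** (T ** A)) $ i $ i = (transpose A *v column i (T ** A)) $ i"
    by (simp add: matrix_matrix_mult_def matrix_vector_mult_def column_def)
  finally show ?thesis
    by (simp only: transpose_mult_vec_nth matrix_mult_column T_def)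
qed

text \<open>Makes both the weight of the logarithm and the denominator of the update positive, so
  division by zero never occurs.\<close>

lemma post_cov_diagonal_less:
  assumes "\<beta> > 0" "\<gamma> \<in> pos_orthant" "post_mean A \<beta> y \<gamma> $ i \<noteq> 0"
  shows "post_cov A \<beta> \<gamma> $ i $ i < \<gamma> $ i"
proof -
  have "column i A \<noteq> 0"
    using assms(3) by (auto simp: post_mean_nth)
  moreover have "\<gamma> $ i > 0"
    using assms(2) by (simp add: pos_orthant_def)
  ultimately have "\<gamma> $ i - post_cov A \<beta> \<gamma> $ i $ i > 0"
    unfolding post_cov_diagonal
    by (intro mult_pos_pos S_mat_inverse_positive_definite assms) simp_all
  then show ?thesis
    by simp
qed

text \<open>One step of the equivalence. The candidate u is an arbitrary vector, so the lemma also
  applies to the next iterate of a sequence not known to be positive.\<close>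

lemma surrogate_unique_arg_min_iff:
  fixes A :: "real ^ 'n ^ 'm" and \<gamma> u :: "real ^ 'n"
  assumes "\<beta> > 0" and \<gamma>: "\<gamma> \<in> pos_orthant" and x: "\<And>i. post_mean A \<beta> y \<gamma> $ i \<noteq> 0"
  shows "is_unique_arg_min (\<lambda>u. F_obj A \<beta> y (post_mean A \<beta> y \<gamma>) u + g_MK A \<beta> u \<gamma>)
      (\<lambda>u. u \<in> pos_orthant) u
    \<longleftrightarrow> (\<forall>i. u $ i = \<gamma> $ i * ((post_mean A \<beta> y \<gamma> $ i)\<^sup>2 / (\<gamma> $ i - post_cov A \<beta> \<gamma> $ i $ i)))"
proof -
  define c where "c = (\<chi> i. (post_mean A \<beta> y \<gamma> $ i)\<^sup>2)"
  define w where "w = (\<chi> i. 1 - post_cov A \<beta> \<gamma> $ i $ i / \<gamma> $ i)"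
  define a where "a = (\<chi> i. c $ i / w $ i)"
  have g: "\<gamma> $ i > 0" for i
    using \<gamma> by (simp add: pos_orthant_def)
  have c: "c $ i > 0" for i
    using x by (simp add: c_def)
  have w: "w $ i > 0" for i
    using post_cov_diagonal_less[OF assms(1) \<gamma> x] g by (simp add: w_def)
  have a_eq: "a $ i = \<gamma> $ i * ((post_mean A \<beta> y \<gamma> $ i)\<^sup>2 / (\<gamma> $ i - post_cov A \<beta> \<gamma> $ i $ i))" for i
  proof -
    have "w $ i = (\<gamma> $ i - post_cov A \<beta> \<gamma> $ i $ i) / \<gamma> $ i"
      using g[of i] by (simp add: w_def diff_divide_distrib)
    then show ?thesis
      by (simp add: a_def c_def)
  qed
  \<comment> \<open>Everything in the objective that does not depend on the variable of
    minimization.\<close>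
  define C where "C = \<beta> * (norm (A *v post_mean A \<beta> y \<gamma> - y))\<^sup>2 + ln (det (S_mat A \<beta> \<gamma>))
    - (\<Sum>i\<in>UNIV. w $ i * ln (\<gamma> $ i))"
  have obj: "F_obj A \<beta> y (post_mean A \<beta> y \<gamma>) u + g_MK A \<beta> u \<gamma>
    = C + (\<Sum>i\<in>UNIV. c $ i / u $ i + w $ i * ln (u $ i))" for u
    by (simp add: F_obj_def g_MK_def C_def c_def w_def right_diff_distrib sum.distrib sum_subtractf)
  have "a \<in> pos_orthant"
    using c w by (simp add: a_def pos_orthant_def)
  then show ?thesis
    unfolding obj a_eq[symmetric] vec_eq_iff[symmetric]
    by (intro is_unique_arg_min_strict_iff add_strict_left_mono
        sum_divide_plus_ln_strict_minimum[OF c w]) (simp_all add: a_def)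
qed

theorem proposition3p3:
  fixes A :: "real ^ 'n ^ 'm" and y :: "real ^ 'm" and \<beta> :: real
    and \<gamma> :: "nat \<Rightarrow> real ^ 'n"
  assumes "\<beta> > 0"
    and "\<And>k. \<gamma> k \<in> pos_orthant"
    and "\<And>k i. post_mean A \<beta> y (\<gamma> k) $ i \<noteq> 0"
  shows "(surrogate_recursion A \<beta> y \<gamma> \<longleftrightarrow> MK_recursion A \<beta> y \<gamma>) \<and>
    (\<forall>\<delta> :: nat \<Rightarrow> real ^ 'n. \<delta> 0 = \<gamma> 0 \<longrightarrow>
       (surrogate_recursion A \<beta> y \<gamma> \<and> MK_recursion A \<beta> y \<delta>) \<or>
       (MK_recursion A \<beta> y \<gamma> \<and> surrogate_recursion A \<beta> y \<delta>) \<longrightarrow> \<delta> = \<gamma>)"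
proof (intro conjI allI impI)
  note step = surrogate_unique_arg_min_iff[OF assms]
  show eq: "surrogate_recursion A \<beta> y \<gamma> \<longleftrightarrow> MK_recursion A \<beta> y \<gamma>"
    unfolding surrogate_recursion_def MK_recursion_def step by simp
  fix \<delta> :: "nat \<Rightarrow> real ^ 'n"
  assume "\<delta> 0 = \<gamma> 0" and rec:
    "(surrogate_recursion A \<beta> y \<gamma> \<and> MK_recursion A \<beta> y \<delta>) \<or>
     (MK_recursion A \<beta> y \<gamma> \<and> surrogate_recursion A \<beta> y \<delta>)"
  have "\<delta> k = \<gamma> k" for k
  proof (induction k)
    case 0
    show ?case by fact
  next
    \<comment> \<open>Nothing is assumed about \<delta> beyond its start; the induction hypothesis
      moves each step to \<open>\<gamma> k\<close>, where positivity and nonzero means are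
      known.\<close>
    case (Suc k)
    have "\<delta> (Suc k) $ i = \<gamma> k $ i * ((post_mean A \<beta> y (\<gamma> k) $ i)\<^sup>2 /
        (\<gamma> k $ i - post_cov A \<beta> (\<gamma> k) $ i $ i))" for i
      using rec
    proof
      assume "surrogate_recursion A \<beta> y \<gamma> \<and> MK_recursion A \<beta> y \<delta>"
      then show ?thesis
        unfolding MK_recursion_def Suc[symmetric] by blast
    next
      assume "MK_recursion A \<beta> y \<gamma> \<and> surrogate_recursion A \<beta> y \<delta>"
      then have "\<forall>i. \<delta> (Suc k) $ i = \<gamma> k $ i * ((post_mean A \<beta> y (\<gamma> k) $ i)\<^sup>2 /
          (\<gamma> k $ i - post_cov A \<beta> (\<gamma> k) $ i $ i))"
        \<comment> \<open>The order matters: the formula becomes an arg min while still stated at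
          \<open>\<gamma> k\<close>, and only then is \<open>\<gamma> k\<close> replaced by
          \<open>\<delta> k\<close>.\<close>
        unfolding step[symmetric] unfolding surrogate_recursion_def Suc[symmetric] by blast
      then show ?thesis ..
    qed
    moreover have "MK_recursion A \<beta> y \<gamma>"
      using rec eq by blast
    ultimately show ?case
      by (simp add: vec_eq_iff MK_recursion_def)
  qed
  then show "\<delta> = \<gamma>" ..
qed

end
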